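(* Let $n$ be a non-negative integer, $a$ a constant complex number, $z$ an indeterminate complex variable, and both $f$ and $g$ complex functions analytic and $\vee$-differentiable on an open set in $\mathbb{C}$. Let $D=D_\vee$ denote the $\vee$-derivative. Then: (i) $D(a)=-\infty$; (ii) $D(z)=0$; (iii) $D(a+z)=a$; (iv) $D(n_\vee f)=n_\vee D(f)$; (v) $D(f\vee g)=D(f)\vee D(g)$; (vi) $D(f+g)=[f+D(g)]\vee[D(f)+g]$; (vii) $D(nz)=n_\vee (n-1)z=(n-1)z+\ln(n)$, where $n_\vee(n-1)z$ means $n_\vee$ applied to $(n-1)z$; (viii) $D(z^n)=\log\left[\dfrac{nz^{n-1}e^{z^n}}{e^z}\right]=z^n-z+(n-1)\log(z)+\ln(n)$; (ix) $D^n(nz)=\ln 1+\cdots+\ln n$, where $D^n$ is the $n$-fold iterate of $D$.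
   Context: The element $-\infty$ is adjoined to $\mathbb{C}$, with the conventions $-\infty+w=-\infty$ and $-\infty\vee w=w$ for $w\in\mathbb{C}$, $e^{-\infty}=0$ and $\log(0)=-\infty$. The complex logarithm is the multivalued function $\log(w)=\ln|w|+i\arg(w)$, with the branch left unspecified; equations involving it are in many cases, strictly speaking, equivalences modulo $2\pi i$. The complex join is $z_1\vee z_2:=\log[\exp(z_1)+\exp(z_2)]$; the join of functions is taken pointwise. The inverse of $z$ with respect to $\vee$ is $z+i\pi$. The notation $n_\vee w$ means $w\vee\cdots\vee w$ ($n$ copies), with $1_\vee w=w$; one has $n_\vee w=\ln(n)+w$. $\vee$-derivative: let $G\subseteq\mathbb{C}$ be open, $f:G\to\mathbb{C}\cup\{-\infty\}$, and suppose that for some $z\in\mathbb{C}\cup\{-\infty\}$ the limit $$\lim_{h\to-\infty}\big\{[f(z\vee h)\vee(f(z)+i\pi)]-h\big\}$$ exists and is finite. Then $f$ is called $\vee$-differentiable at $z$, and the limit is denoted $D_\vee f(z)$ (or simply $Df(z)$) and called the $\vee$-derivative of $f$ at $z$. *)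

theory Defs
  imports "HOL-Analysis.Analysis"
begin

section \<open>The complex numbers with an adjoined element minus infinity\<close>

datatype cext = MInf | Fin complex

instantiation cext :: plus
begin

fun plus_cext :: "cext \<Rightarrow> cext \<Rightarrow> cext" where
  "Fin a + Fin b = Fin (a + b)"
| "MInf + w = MInf"
| "w + MInf = MInf"

instance ..

end

fun cexp :: "cext \<Rightarrow> complex" where
  "cexp MInf = 0"
| "cexp (Fin a) = exp a"

text \<open>Integer multiples. The empty multiple of \<open>-\<infinity>\<close> is 0, matching \<open>0 ^ 0 = 1\<close>. For negative
  \<open>k\<close> the multiple of \<open>-\<infinity>\<close> has no meaning; the value chosen here is immaterial in sums with a
  further summand \<open>-\<infinity>\<close>.\<close>

fun cscale :: "int \<Rightarrow> cext \<Rightarrow> cext" where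
  "cscale k (Fin a) = Fin (of_int k * a)"
| "cscale k MInf = (if k = 0 then Fin 0 else MInf)"

definition ln_nat :: "nat \<Rightarrow> cext" where
  "ln_nat n = (if n = 0 then MInf else Fin (of_real (ln (real n))))"

definition eq_mod_2pi :: "cext \<Rightarrow> cext \<Rightarrow> bool"  (infix "\<doteq>" 50) where
  "v \<doteq> w \<longleftrightarrow> v = w \<or>
     (\<exists>a (k::int). v = Fin a \<and> w = Fin (a + 2 * of_real pi * \<i> * of_int k))"


section \<open>Multivalued logarithm and join\<close>

text \<open>The logarithm has no preferred branch, so it is represented by the set of all its values,
  and so are the operations derived from it. An equation whose right-hand side is multivalued
  is rendered as membership.\<close>

definition clog :: "complex \<Rightarrow> cext set" where
  "clog w = (if w = 0 then {MInf}
             else {Fin (of_real (ln (norm w)) + \<i> * of_real t) |t. is_Arg w t})"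

definition vjoin :: "cext \<Rightarrow> cext \<Rightarrow> cext set" where
  "vjoin v w = clog (cexp v + cexp w)"

text \<open>The \<open>n\<close>-fold join \<open>w \<or> \<dots> \<or> w\<close>; the empty join is the neutral element \<open>-\<infinity>\<close>.\<close>

fun vfold :: "nat \<Rightarrow> cext \<Rightarrow> cext set" where
  "vfold 0 w = {MInf}"
| "vfold (Suc n) w = (\<Union>v\<in>vfold n w. vjoin v w)"

lemma mem_clog_iff: "v \<in> clog w \<longleftrightarrow> cexp v = w"
proof (cases v)
  case MInf
  then show ?thesis by (auto simp: clog_def)
next
  case (Fin a)
  show ?thesis
  proof (cases "w = 0")
    case True
    then show ?thesis using Fin by (auto simp: clog_def)
  next
    case False
    have "(\<exists>t. a = of_real (ln (norm w)) + \<i> * of_real t \<and> is_Arg w t) \<longleftrightarrow> exp a = w"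
    proof
      assume "\<exists>t. a = of_real (ln (norm w)) + \<i> * of_real t \<and> is_Arg w t"
      then obtain t where t: "a = of_real (ln (norm w)) + \<i> * of_real t" "is_Arg w t" by blast
      have "exp a = of_real (exp (ln (norm w))) * exp (\<i> * of_real t)"
        unfolding t(1) exp_add by (simp only: exp_of_real)
      also have "\<dots> = w" using t(2) False by (simp add: is_Arg_def)
      finally show "exp a = w" .
    next
      assume w: "exp a = w"
      have n: "ln (norm w) = Re a" unfolding w[symmetric] by (simp add: norm_exp_eq_Re)
      have "is_Arg w (Im a)"
        unfolding w[symmetric] is_Arg_def norm_exp_eq_Re
        using exp_eq_polar[of a] by (simp only: cis_conv_exp)
      then show "\<exists>t. a = of_real (ln (norm w)) + \<i> * of_real t \<and> is_Arg w t"
        unfolding n by (metis complex_eq)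
    qed
    then show ?thesis using Fin False by (auto simp: clog_def)
  qed
qed

lemma mem_clog_iff_eq_mod: "v \<in> clog (cexp w) \<longleftrightarrow> v \<doteq> w"
proof -
  have "exp a = exp b \<longleftrightarrow> (\<exists>k::int. b = a + 2 * of_real pi * \<i> * of_int k)" for a b :: complex
  proof -
    have "exp a = exp b \<longleftrightarrow> exp b = exp a" by auto
    then show ?thesis unfolding exp_eq[of b a] by (simp add: mult_ac)
  qed
  then show ?thesis
    by (cases v; cases w) (simp_all add: mem_clog_iff eq_mod_2pi_def, metis add_0_right mult_zero_right of_int_0)
qed

lemma mem_vfold_iff: "v \<in> vfold n w \<longleftrightarrow> v \<doteq> w + ln_nat n"
proof -
  have "(v \<in> vfold n w) = (cexp v = of_nat n * cexp w)"
  proof (induction n arbitrary: v)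
    case 0
    then show ?case by (cases v) auto
  next
    case (Suc n)
    have "\<exists>u. cexp u = of_nat n * cexp w"
    proof (cases "of_nat n * cexp w = 0")
      case True
      then show ?thesis by (metis cexp.simps(1))
    next
      case False
      then show ?thesis by (metis cexp.simps(2) exp_Ln)
    qed
    then show ?case using Suc by (auto simp: vjoin_def mem_clog_iff algebra_simps)
  qed
  moreover have "cexp (w + ln_nat n) = of_nat n * cexp w"
  proof (cases w)
    case (Fin a)
    have "exp (of_real (ln (real n))) = (of_nat n :: complex)" if "n > 0"
      using that by (simp add: exp_of_real)
    then show ?thesis using Fin by (auto simp: ln_nat_def exp_add)
  qed (simp add: ln_nat_def)
  ultimately show ?thesis
    by (simp add: mem_clog_iff flip: mem_clog_iff_eq_mod)
qed


section \<open>The join derivative\<close>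

text \<open>The filter of complex \<open>h\<close> tending to \<open>-\<infinity>\<close>, that is, with \<open>exp h\<close> tending to 0.\<close>

definition at_cminf :: "complex filter" where
  "at_cminf = filtercomap Re at_bot"

fun cnhds :: "cext \<Rightarrow> cext filter" where
  "cnhds (Fin a) = filtermap Fin (nhds a)"
| "cnhds MInf = sup (principal {MInf}) (filtermap Fin at_cminf)"

text \<open>\<open>u\<close> selects, for each \<open>h\<close> close to \<open>-\<infinity>\<close>, a value \<open>u h\<close> of \<open>z \<or> h\<close>, on the branch that tends
  to \<open>z \<or> -\<infinity> = z\<close>. Fixing this branch is necessary since functions of \<open>z\<close> need not have
  period \<open>2 \<pi> i\<close>; \<open>u h\<close> is then determined for all \<open>h\<close> close to \<open>-\<infinity>\<close>.\<close>

definition join_branch :: "complex \<Rightarrow> (complex \<Rightarrow> complex) \<Rightarrow> bool" where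
  "join_branch z u \<longleftrightarrow>
     (\<forall>\<^sub>F h in at_cminf. Fin (u h) \<in> vjoin (Fin z) (Fin h)) \<and> (u \<longlongrightarrow> z) at_cminf"

lemma join_branch_exists: "\<exists>u. join_branch z u"
proof
  let ?u = "\<lambda>h. z + Ln (1 + exp (h - z))"
  have bot: "filterlim Re at_bot at_cminf"
    unfolding at_cminf_def by (rule filterlim_filtercomap)
  have "((\<lambda>h. exp (Re h)) \<longlongrightarrow> 0) at_cminf"
    by (rule filterlim_compose[OF exp_at_bot bot])
  then have "((\<lambda>h. exp h) \<longlongrightarrow> (0::complex)) at_cminf"
    by (subst tendsto_norm_zero_iff[symmetric]) (simp add: norm_exp_eq_Re)
  then have "((\<lambda>h. exp h / exp z) \<longlongrightarrow> 0 / exp z) at_cminf"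
    by (intro tendsto_intros) auto
  then have e: "((\<lambda>h. exp (h - z)) \<longlongrightarrow> 0) at_cminf"
    by (simp add: exp_diff)
  then have l: "((\<lambda>h. 1 + exp (h - z)) \<longlongrightarrow> 1) at_cminf"
    using tendsto_add[OF tendsto_const[of 1] e] by simp
  have "((\<lambda>h. z + Ln (1 + exp (h - z))) \<longlongrightarrow> z + Ln 1) at_cminf"
    by (intro tendsto_add tendsto_const tendsto_Ln l) auto
  moreover have "\<forall>\<^sub>F h in at_cminf. 1 + exp (h - z) \<noteq> 0"
    using tendsto_imp_eventually_ne[OF l, of 0] by simp
  then have "\<forall>\<^sub>F h in at_cminf. Fin (?u h) \<in> vjoin (Fin z) (Fin h)"
    by eventually_elim (simp add: vjoin_def mem_clog_iff exp_add exp_diff field_simps)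
  ultimately show "join_branch z ?u" by (simp add: join_branch_def)
qed

text \<open>Since the join is multivalued, the limit is one modulo \<open>2 \<pi> i\<close>: the values of
  \<open>[f(z \<or> h) \<or> (f(z) + i \<pi>)] - h\<close> can be selected so as to converge to \<open>L\<close>. The value
  \<open>L = -\<infinity>\<close> is allowed; it is the limit for constant functions.\<close>

definition has_vderiv :: "(complex \<Rightarrow> cext) \<Rightarrow> cext \<Rightarrow> complex \<Rightarrow> bool" where
  "has_vderiv f L z \<longleftrightarrow>
     (\<forall>u. join_branch z u \<longrightarrow>
        (\<exists>q. (\<forall>h. q h \<in> (\<lambda>w. w + Fin (- h)) ` vjoin (f (u h)) (f z + Fin (\<i> * of_real pi))) \<and>
             filterlim q (cnhds L) at_cminf))"

definition vdifferentiable :: "(complex \<Rightarrow> cext) \<Rightarrow> complex \<Rightarrow> bool" where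
  "vdifferentiable f z \<longleftrightarrow> (\<exists>L. has_vderiv f L z)"

text \<open>The derivative is determined modulo \<open>2 \<pi> i\<close> only; \<open>vD\<close> takes an unspecified
  representative at each point.\<close>

definition vD :: "(complex \<Rightarrow> cext) \<Rightarrow> complex \<Rightarrow> cext" where
  "vD f z = (SOME L. has_vderiv f L z)"

end

theory Submission
  imports Defs
begin

text \<open>Everything is transported along \<open>exp\<close>: the join of \<open>v\<close> and \<open>w\<close> is the set of preimages
  of \<open>exp v + exp w\<close>, and \<open>exp h = exp (z \<or> h) - exp z\<close>. Hence the exponential of the join
  difference quotient of \<open>f\<close> is the quotient of the increments of \<open>exp \<circ> f\<close> and \<open>exp\<close>
  between \<open>z\<close> and \<open>z \<or> h\<close>, so that \<open>exp (D f z) = (exp \<circ> f)' z / exp z\<close>. All nine rules are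
  then rules of ordinary differentiation.\<close>

section \<open>Exponentials of sums, joins and multiples\<close>

lemma cexp_add: "cexp (v + w) = cexp v * cexp w"
  by (cases v; cases w) (simp_all add: exp_add)

lemma cexp_ln_nat: "cexp (ln_nat n) = of_nat n"
  by (simp add: ln_nat_def exp_of_real)

lemma cexp_eq_0_iff [simp]: "cexp v = 0 \<longleftrightarrow> v = MInf"
  by (cases v) auto

lemma surj_cexp: "\<exists>v. cexp v = w"
  by (metis cexp.simps exp_Ln)

lemma eq_mod_2pi_iff: "v \<doteq> w \<longleftrightarrow> cexp v = cexp w"
  by (simp add: mem_clog_iff flip: mem_clog_iff_eq_mod)

lemma mem_vjoin_iff: "v \<in> vjoin x y \<longleftrightarrow> cexp v = cexp x + cexp y"
  by (simp add: vjoin_def mem_clog_iff)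

lemma mem_vfold_iff_cexp: "v \<in> vfold n w \<longleftrightarrow> cexp v = of_nat n * cexp w"
  by (simp add: mem_vfold_iff eq_mod_2pi_iff cexp_add cexp_ln_nat mult.commute)

section \<open>Limits through the extended exponential\<close>

lemma at_cminf_neq_bot: "at_cminf \<noteq> bot"
proof -
  have "surj Re"
    by (rule surjI[of _ complex_of_real]) simp
  then show ?thesis
    unfolding at_cminf_def by (intro filtercomap_neq_bot_surj) auto
qed

lemma tendsto_exp_at_cminf: "(exp \<longlongrightarrow> (0::complex)) at_cminf"
proof -
  have "((\<lambda>h. exp (Re h)) \<longlongrightarrow> 0) at_cminf"
    unfolding at_cminf_def by (rule filterlim_compose[OF exp_at_bot filterlim_filtercomap])
  then show ?thesis
    by (subst tendsto_norm_zero_iff[symmetric]) (simp add: norm_exp_eq_Re)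
qed

text \<open>For finite \<open>L\<close> this is continuity of \<open>exp\<close>. For
  \<open>MInf\<close>, the filter combines the point itself, where \<open>cexp\<close> is 0, with
  left half-planes, along which \<open>exp\<close> tends to 0.\<close>

lemma tendsto_cexp: "(cexp \<longlongrightarrow> cexp L) (cnhds L)"
proof (cases L)
  case MInf
  have "(cexp \<longlongrightarrow> 0) (principal {MInf})"
    by (simp add: tendsto_def eventually_principal)
  moreover have "(cexp \<longlongrightarrow> 0) (filtermap Fin at_cminf)"
    using tendsto_exp_at_cminf by (simp add: filterlim_filtermap)
  ultimately show ?thesis
    using MInf by (simp add: filterlim_sup)
next
  case (Fin a)
  have "(exp \<longlongrightarrow> exp a) (nhds a)"
    by (intro tendsto_intros filterlim_ident)
  then show ?thesis
    using Fin by (simp add: filterlim_filtermap)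
qed

text \<open>A converse to \<open>tendsto_cexp\<close>, for suitably chosen logarithms. At
  \<open>MInf\<close> every choice works, since \<open>norm (r h)\<close> determines the real part;
  a finite limit calls for a branch that is continuous near \<open>cexp L\<close>.\<close>

lemma cexp_lift:
  assumes "(r \<longlongrightarrow> cexp L) A"
  obtains q where "\<And>h. cexp (q h) = r h" and "filterlim q (cnhds L) A"
proof (cases L)
  case MInf
  have "\<forall>h. \<exists>v. cexp v = r h"
    using surj_cexp by blast
  then obtain q where q: "\<And>h. cexp (q h) = r h"
    by metis
  have "\<forall>\<^sub>F h in A. P (q h)" if P: "eventually P (cnhds MInf)" for P
  proof -
    \<comment> \<open>A neighbourhood of \<open>MInf\<close> contains a half-plane
      \<open>Re a \<le> N\<close>. As \<open>norm (exp a) = exp (Re a)\<close>, it is enough that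
      \<open>norm (r h) < exp N\<close>.\<close>
    from P obtain N where N: "P MInf" "\<And>a. Re a \<le> N \<Longrightarrow> P (Fin a)"
      by (auto simp: eventually_sup eventually_principal eventually_filtermap at_cminf_def
          eventually_filtercomap eventually_at_bot_linorder)
    have "\<forall>\<^sub>F h in A. norm (r h) < exp N"
      using assms MInf by (simp add: tendsto_iff)
    then show ?thesis
    proof eventually_elim
      case (elim h)
      then show ?case
        using q[of h] N by (cases "q h") (auto simp flip: q simp: norm_exp_eq_Re)
    qed
  qed
  then show ?thesis
    using that q MInf by (auto simp: filterlim_iff)
next
  case (Fin a)
  \<comment> \<open>Dividing by \<open>exp a\<close> moves the limit to 1, where \<open>Ln\<close>
    is continuous with value 0. Where \<open>r h = 0\<close> only \<open>MInf\<close> is a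
    logarithm; eventually this no longer occurs.\<close>
  define p where "p h = a + Ln (r h / exp a)" for h
  define q where "q h = (if r h = 0 then MInf else Fin (p h))" for h
  have r: "(r \<longlongrightarrow> exp a) A"
    using assms Fin by simp
  have "((\<lambda>h. r h / exp a) \<longlongrightarrow> exp a / exp a) A"
    by (intro tendsto_intros r) auto
  then have "((\<lambda>h. r h / exp a) \<longlongrightarrow> 1) A"
    by simp
  then have "(p \<longlongrightarrow> a + Ln 1) A"
    unfolding p_def by (intro tendsto_add tendsto_const tendsto_Ln) auto
  then have "filterlim (\<lambda>h. Fin (p h)) (filtermap Fin (nhds a)) A"
    by (auto simp: filterlim_def filtermap_filtermap[symmetric] intro: filtermap_mono)
  moreover have "\<forall>\<^sub>F h in A. r h \<noteq> 0"
    using tendsto_imp_eventually_ne[OF r] by simp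
  then have "\<forall>\<^sub>F h in A. Fin (p h) = q h"
    by eventually_elim (simp add: q_def)
  ultimately have "filterlim q (cnhds L) A"
    using Fin by (simp add: filterlim_cong[OF refl refl])
  moreover have "cexp (q h) = r h" for h
    by (simp add: q_def p_def exp_add)
  ultimately show ?thesis
    using that by blast
qed

section \<open>Join derivatives as ordinary derivatives\<close>

text \<open>The shift by \<open>\<i> * of_real pi\<close> multiplies the exponential by -1, and the
  shift by \<open>- h\<close> divides it by \<open>exp h\<close>.\<close>

lemma mem_vquotient_iff:
  "v \<in> (\<lambda>w. w + Fin (- h)) ` vjoin x (y + Fin (\<i> * of_real pi)) \<longleftrightarrow>
     cexp v = (cexp x - cexp y) / exp h" (is "?lhs \<longleftrightarrow> ?rhs")
proof
  assume ?lhs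
  then show ?rhs
    by (auto simp: mem_vjoin_iff cexp_add exp_minus divide_simps)
next
  assume ?rhs
  then have "v + Fin h \<in> vjoin x (y + Fin (\<i> * of_real pi))"
    by (simp add: mem_vjoin_iff cexp_add)
  moreover have "v = (v + Fin h) + Fin (- h)"
    by (cases v) auto
  ultimately show ?lhs by blast
qed

text \<open>By \<open>tendsto_cexp\<close> and \<open>cexp_lift\<close> the selection
  \<open>q\<close> disappears, leaving an ordinary limit of complex numbers.\<close>

lemma has_vderiv_iff:
  "has_vderiv F L z \<longleftrightarrow>
     (\<forall>u. join_branch z u \<longrightarrow>
        ((\<lambda>h. (cexp (F (u h)) - cexp (F z)) / exp h) \<longlongrightarrow> cexp L) at_cminf)"
  (is "_ \<longleftrightarrow> (\<forall>u. _ \<longrightarrow> (?r u \<longlongrightarrow> _) _)")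
proof -
  have "(\<exists>q. (\<forall>h. cexp (q h) = ?r u h) \<and> filterlim q (cnhds L) at_cminf) \<longleftrightarrow>
        (?r u \<longlongrightarrow> cexp L) at_cminf" for u
  proof
    assume "\<exists>q. (\<forall>h. cexp (q h) = ?r u h) \<and> filterlim q (cnhds L) at_cminf"
    then obtain q where q: "\<And>h. cexp (q h) = ?r u h" "filterlim q (cnhds L) at_cminf"
      by blast
    show "(?r u \<longlongrightarrow> cexp L) at_cminf"
      using filterlim_compose[OF tendsto_cexp q(2)] by (simp add: q(1))
  next
    assume "(?r u \<longlongrightarrow> cexp L) at_cminf"
    then show "\<exists>q. (\<forall>h. cexp (q h) = ?r u h) \<and> filterlim q (cnhds L) at_cminf"
      by (rule cexp_lift) blast
  qed
  then show ?thesis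
    by (simp add: has_vderiv_def mem_vquotient_iff)
qed

text \<open>Some branch \<open>u\<close> exists, so the quantifier over branches is not vacuous;
  uniqueness of limits along a nontrivial filter does the rest.\<close>

lemma has_vderiv_unique:
  assumes "has_vderiv F L z" and "has_vderiv F M z"
  shows "L \<doteq> M"
proof -
  obtain u where "join_branch z u"
    using join_branch_exists by blast
  then show ?thesis
    using assms tendsto_unique[OF at_cminf_neq_bot]
    unfolding has_vderiv_iff eq_mod_2pi_iff by blast
qed

lemma has_vderiv_if_has_field_derivative:
  assumes E: "((\<lambda>w. cexp (F w)) has_field_derivative E) (at z)" and L: "cexp L = E / exp z"
  shows "has_vderiv F L z"
  unfolding has_vderiv_iff
proof (intro allI impI)
  fix u assume u: "join_branch z u"
  have ev: "\<forall>\<^sub>F h in at_cminf. exp h = exp (u h) - exp z"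
    using u by (auto simp: join_branch_def mem_vjoin_iff elim: eventually_mono)
  \<comment> \<open>Since \<open>exp h\<close> never vanishes, \<open>u h\<close> avoids
    \<open>z\<close>, as limits in a punctured neighbourhood require.\<close>
  then have "\<forall>\<^sub>F h in at_cminf. u h \<noteq> z"
    by eventually_elim auto
  then have lim: "filterlim u (at z) at_cminf"
    using u by (auto simp: join_branch_def filterlim_at)
  \<comment> \<open>Dividing both increments by \<open>w - z\<close> gives two difference quotients;
    the lower one tends to \<open>exp z\<close>, which is nonzero.\<close>
  have "((\<lambda>w. ((cexp (F w) - cexp (F z)) / (w - z)) / ((exp w - exp z) / (w - z)))
          \<longlongrightarrow> E / exp z) (at z)"
    using E DERIV_exp[of z] unfolding has_field_derivative_iff
    by (intro tendsto_divide) auto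
  then have "((\<lambda>w. (cexp (F w) - cexp (F z)) / (exp w - exp z)) \<longlongrightarrow> E / exp z) (at z)"
    by (rule Lim_transform_eventually) (auto simp: eventually_at_filter)
  from filterlim_compose[OF this lim]
  show "((\<lambda>h. (cexp (F (u h)) - cexp (F z)) / exp h) \<longlongrightarrow> cexp L) at_cminf"
    unfolding L by (rule Lim_transform_eventually) (use ev in eventually_elim, simp)
qed

text \<open>The choice of representative in \<open>vD\<close> does not affect its exponential, by
  uniqueness.\<close>

lemma
  assumes "((\<lambda>w. cexp (F w)) has_field_derivative E) (at z)"
  shows vdifferentiableI: "vdifferentiable F z"
    and cexp_vD: "cexp (vD F z) = E / exp z"
proof -
  obtain L where L: "cexp L = E / exp z"
    using surj_cexp by blast
  have has: "has_vderiv F L z"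
    using has_vderiv_if_has_field_derivative[OF assms L] .
  then show "vdifferentiable F z"
    by (auto simp: vdifferentiable_def)
  have "has_vderiv F (vD F z) z"
    unfolding vD_def using has by (rule someI)
  then show "cexp (vD F z) = E / exp z"
    using has_vderiv_unique[OF has] by (simp add: eq_mod_2pi_iff L)
qed

section \<open>Rules for the first derivative\<close>

lemma vD_const: "vdifferentiable (\<lambda>z. c) z \<and> vD (\<lambda>z. c) z = MInf"
proof -
  have "((\<lambda>w. cexp c) has_field_derivative 0) (at z)"
    by simp
  \<comment> \<open>Only \<open>MInf\<close> has exponential 0, which yields an equality rather than
    a congruence.\<close>
  from vdifferentiableI[OF this] cexp_vD[OF this] show ?thesis by simp
qed

lemma
  assumes "(f has_field_derivative f') (at z)"
  shows vdifferentiable_Fin: "vdifferentiable (\<lambda>w. Fin (f w)) z"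
    and cexp_vD_Fin: "cexp (vD (\<lambda>w. Fin (f w)) z) = f' * exp (f z) / exp z"
proof -
  have *: "((\<lambda>w. cexp (Fin (f w))) has_field_derivative f' * exp (f z)) (at z)"
    by (auto intro!: derivative_eq_intros assms)
  show "vdifferentiable (\<lambda>w. Fin (f w)) z"
    and "cexp (vD (\<lambda>w. Fin (f w)) z) = f' * exp (f z) / exp z"
    using vdifferentiableI[OF *] cexp_vD[OF *] by simp_all
qed

lemma vD_add_const:
  "vdifferentiable (\<lambda>z. Fin (a + z)) z \<and> vD (\<lambda>z. Fin (a + z)) z \<doteq> Fin a"
proof -
  have *: "((\<lambda>z. a + z) has_field_derivative 1) (at z)"
    by (auto intro!: derivative_eq_intros)
  show ?thesis
    using vdifferentiable_Fin[OF *] cexp_vD_Fin[OF *] by (simp add: eq_mod_2pi_iff exp_add)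
qed

text \<open>\<open>F\<close> may jump between branches from point to point. Only
  \<open>cexp (F w)\<close> matters, and near \<open>z\<close> it is the smooth function
  \<open>of_nat n * exp (f w)\<close>. The same reasoning serves \<open>vD_vjoin\<close>.\<close>

lemma vD_vfold:
  assumes "open G" "z \<in> G" and f: "(f has_field_derivative f') (at z)"
    and F: "\<forall>z\<in>G. F z \<in> vfold n (Fin (f z))"
  shows "vdifferentiable F z \<and> vD F z \<in> vfold n (vD (\<lambda>z. Fin (f z)) z)"
proof -
  have "((\<lambda>w. of_nat n * exp (f w)) has_field_derivative of_nat n * (f' * exp (f z))) (at z)"
    by (auto intro!: derivative_eq_intros f)
  then have *: "((\<lambda>w. cexp (F w)) has_field_derivative of_nat n * (f' * exp (f z))) (at z)"
    using F by (auto intro: has_field_derivative_transform_within_open[OF _ assms(1,2)]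
        simp: mem_vfold_iff_cexp)
  show ?thesis
    using vdifferentiableI[OF *] cexp_vD[OF *] cexp_vD_Fin[OF f] by (simp add: mem_vfold_iff_cexp)
qed

lemma vD_vjoin:
  assumes "open G" "z \<in> G"
    and f: "(f has_field_derivative f') (at z)" and g: "(g has_field_derivative g') (at z)"
    and F: "\<forall>z\<in>G. F z \<in> vjoin (Fin (f z)) (Fin (g z))"
  shows "vdifferentiable F z \<and>
     vD F z \<in> vjoin (vD (\<lambda>z. Fin (f z)) z) (vD (\<lambda>z. Fin (g z)) z)"
proof -
  have "((\<lambda>w. exp (f w) + exp (g w)) has_field_derivative f' * exp (f z) + g' * exp (g z)) (at z)"
    by (auto intro!: derivative_eq_intros f g)
  then have *: "((\<lambda>w. cexp (F w)) has_field_derivative f' * exp (f z) + g' * exp (g z)) (at z)"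
    using F by (auto intro: has_field_derivative_transform_within_open[OF _ assms(1,2)]
        simp: mem_vjoin_iff)
  show ?thesis
    using vdifferentiableI[OF *] cexp_vD[OF *] cexp_vD_Fin[OF f] cexp_vD_Fin[OF g]
    by (simp add: mem_vjoin_iff add_divide_distrib)
qed

text \<open>This is the product rule for \<open>exp f * exp g\<close>: each summand of
  \<open>(f' + g') * exp (f z + g z) / exp z\<close> is the exponential of one of the joined
  terms.\<close>

lemma vD_add:
  assumes f: "(f has_field_derivative f') (at z)" and g: "(g has_field_derivative g') (at z)"
  shows "vdifferentiable (\<lambda>z. Fin (f z + g z)) z \<and>
     vD (\<lambda>z. Fin (f z + g z)) z \<in>
       vjoin (Fin (f z) + vD (\<lambda>z. Fin (g z)) z) (vD (\<lambda>z. Fin (f z)) z + Fin (g z))"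
  using vdifferentiable_Fin[OF DERIV_add[OF f g]] cexp_vD_Fin[OF DERIV_add[OF f g]]
    cexp_vD_Fin[OF f] cexp_vD_Fin[OF g]
  by (simp add: mem_vjoin_iff cexp_add exp_add add_divide_distrib distrib_right ac_simps)

lemma vD_mult_nat:
  "vdifferentiable (\<lambda>z. Fin (of_nat n * z)) z \<and>
   vD (\<lambda>z. Fin (of_nat n * z)) z \<in> vfold n (Fin ((of_nat n - 1) * z))"
proof -
  have *: "((\<lambda>z. of_nat n * z) has_field_derivative of_nat n) (at z)"
    by (auto intro!: derivative_eq_intros)
  show ?thesis
    using vdifferentiable_Fin[OF *] cexp_vD_Fin[OF *]
    by (simp add: mem_vfold_iff_cexp exp_diff left_diff_distrib)
qed

lemma vD_power:
  shows "vdifferentiable (\<lambda>z. Fin (z ^ n)) z" (is ?diff)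
    and "vD (\<lambda>z. Fin (z ^ n)) z \<in>
           clog (of_nat n * z powi (int n - 1) * exp (z ^ n) / exp z)" (is ?clog)
    and "l \<in> clog z \<Longrightarrow> vD (\<lambda>z. Fin (z ^ n)) z \<doteq>
           Fin (z ^ n - z) + cscale (int n - 1) l + ln_nat n"
proof -
  have *: "((\<lambda>z. z ^ n) has_field_derivative of_nat n * z ^ (n - 1)) (at z)"
    by (auto intro!: derivative_eq_intros)
  \<comment> \<open>For \<open>n = 0\<close> the exponents are 0 and -1, but the factor
    \<open>of_nat n\<close> annihilates both sides.\<close>
  have pow: "of_nat n * z ^ (n - 1) = of_nat n * z powi (int n - 1)"
    by (cases n) (auto simp: power_int_def)
  show ?diff
    by (rule vdifferentiable_Fin[OF *])
  have D: "cexp (vD (\<lambda>z. Fin (z ^ n)) z) = of_nat n * z ^ (n - 1) * exp (z ^ n) / exp z"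
    by (rule cexp_vD_Fin[OF *])
  then show ?clog
    by (simp only: mem_clog_iff pow)
  assume "l \<in> clog z"
  then have "cexp l = z"
    by (simp add: mem_clog_iff)
  \<comment> \<open>If \<open>z = 0\<close> then \<open>l\<close> is \<open>MInf\<close>. For
    \<open>n = 1\<close>, \<open>cscale\<close> gives \<open>Fin 0\<close>, matching
    \<open>0 ^ 0 = 1\<close>; for larger \<open>n\<close> both powers vanish. For
    \<open>n = 0\<close> the conventional value is multiplied by 0.\<close>
  then have "of_nat n * cexp (cscale (int n - 1) l) = of_nat n * z ^ (n - 1)"
    by (cases n; cases l) (auto simp: exp_of_nat_mult)
  then show "vD (\<lambda>z. Fin (z ^ n)) z \<doteq> Fin (z ^ n - z) + cscale (int n - 1) l + ln_nat n"
    by (auto simp: eq_mod_2pi_iff cexp_add cexp_ln_nat D exp_diff)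
qed

section \<open>Iterated derivatives\<close>

text \<open>Each differentiation brings down the factor \<open>n - k\<close>, and division by
  \<open>exp z\<close> lowers the exponent by one. The factors accumulate to a falling factorial,
  which is \<open>fact n\<close> for \<open>k = n\<close>.\<close>

lemma cexp_vD_funpow_mult_nat:
  assumes "k \<le> n"
  shows "cexp ((vD ^^ k) (\<lambda>z. Fin (of_nat n * z)) z) =
    of_nat (fact n div fact (n - k)) * exp (of_nat (n - k) * z)"
  using assms
proof (induction k arbitrary: z)
  case (Suc k)
  let ?c = "of_nat (fact n div fact (n - k)) :: complex"
  have k: "n - k = Suc (n - Suc k)"
    using Suc.prems by simp
  have "((\<lambda>w. ?c * exp (of_nat (n - k) * w)) has_field_derivative
          ?c * (exp (of_nat (n - k) * z) * of_nat (n - k))) (at z)"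
    by (auto intro!: derivative_eq_intros)
  \<comment> \<open>The representatives chosen by \<open>vD\<close> need not be continuous in
    \<open>w\<close>; the induction hypothesis at every point gives their exponentials, and those
    are differentiable.\<close>
  then have "((\<lambda>w. cexp ((vD ^^ k) (\<lambda>z. Fin (of_nat n * z)) w)) has_field_derivative
          ?c * (exp (of_nat (n - k) * z) * of_nat (n - k))) (at z)"
    using Suc by simp
  from cexp_vD[OF this]
  have "cexp ((vD ^^ Suc k) (\<lambda>z. Fin (of_nat n * z)) z) =
    (?c * of_nat (n - k)) * (exp (of_nat (n - k) * z) / exp z)"
    by simp
  also have "exp (of_nat (n - k) * z) / exp z = exp (of_nat (n - Suc k) * z)"
    unfolding k by (simp add: exp_add distrib_right)
  also have "?c * of_nat (n - k) = of_nat (fact n div fact (n - Suc k))"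
  proof -
    have "fact n div fact (n - k) * (n - k) = (fact n div fact (n - Suc k) :: nat)"
    proof -
      have "fact (n - k) dvd (fact n :: nat)"
        by (simp add: fact_dvd)
      then obtain m where m: "fact n = fact (n - k) * (m :: nat)"
        by blast
      have "fact (n - k) = (n - k) * (fact (n - Suc k) :: nat)"
        unfolding k by simp
      then show ?thesis
        unfolding m by (simp add: mult.assoc mult.left_commute)
    qed
    then show ?thesis
      by (metis of_nat_mult)
  qed
  finally show ?case .
qed simp

lemma vdifferentiable_funpow_mult_nat:
  assumes "k \<le> n"
  shows "vdifferentiable ((vD ^^ k) (\<lambda>z. Fin (of_nat n * z))) z"
proof (rule vdifferentiableI)
  show "((\<lambda>w. cexp ((vD ^^ k) (\<lambda>z. Fin (of_nat n * z)) w)) has_field_derivative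
      of_nat (fact n div fact (n - k)) * (exp (of_nat (n - k) * z) * of_nat (n - k))) (at z)"
    unfolding cexp_vD_funpow_mult_nat[OF assms] by (auto intro!: derivative_eq_intros)
qed

lemma exp_sum_ln_eq_fact: "exp (of_real (\<Sum>k=1..n. ln (real k))) = (fact n :: complex)"
  by (induction n) (simp_all add: exp_add exp_of_real algebra_simps)

lemma vD_funpow_mult_nat:
  "(vD ^^ n) (\<lambda>z. Fin (of_nat n * z)) z \<doteq> Fin (of_real (\<Sum>k=1..n. ln (real k)))"
  unfolding eq_mod_2pi_iff cexp_vD_funpow_mult_nat[OF order_refl] cexp.simps exp_sum_ln_eq_fact
  by simp

theorem theorem5p4:
  fixes n :: nat and a :: complex and f g :: "complex \<Rightarrow> complex" and G :: "complex set"
  assumes "open G"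
    and "f analytic_on G" and "g analytic_on G"
    and "\<And>z. z \<in> G \<Longrightarrow> vdifferentiable (\<lambda>z. Fin (f z)) z"
    and "\<And>z. z \<in> G \<Longrightarrow> vdifferentiable (\<lambda>z. Fin (g z)) z"
  shows
    "(\<forall>z. vdifferentiable (\<lambda>z. Fin a) z \<and> vD (\<lambda>z. Fin a) z = MInf) \<and>
     (\<forall>z. vdifferentiable (\<lambda>z. Fin z) z \<and> vD (\<lambda>z. Fin z) z \<doteq> Fin 0) \<and>
     (\<forall>z. vdifferentiable (\<lambda>z. Fin (a + z)) z \<and> vD (\<lambda>z. Fin (a + z)) z \<doteq> Fin a) \<and>
     (\<forall>F. (\<forall>z\<in>G. F z \<in> vfold n (Fin (f z))) \<longrightarrow>
        (\<forall>z\<in>G. vdifferentiable F z \<and> vD F z \<in> vfold n (vD (\<lambda>z. Fin (f z)) z))) \<and>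
     (\<forall>F. (\<forall>z\<in>G. F z \<in> vjoin (Fin (f z)) (Fin (g z))) \<longrightarrow>
        (\<forall>z\<in>G. vdifferentiable F z \<and>
           vD F z \<in> vjoin (vD (\<lambda>z. Fin (f z)) z) (vD (\<lambda>z. Fin (g z)) z))) \<and>
     (\<forall>z\<in>G. vdifferentiable (\<lambda>z. Fin (f z + g z)) z \<and>
        vD (\<lambda>z. Fin (f z + g z)) z \<in>
          vjoin (Fin (f z) + vD (\<lambda>z. Fin (g z)) z) (vD (\<lambda>z. Fin (f z)) z + Fin (g z))) \<and>
     (\<forall>z. vdifferentiable (\<lambda>z. Fin (of_nat n * z)) z \<and>
        vD (\<lambda>z. Fin (of_nat n * z)) z \<in> vfold n (Fin ((of_nat n - 1) * z)) \<and>
        vD (\<lambda>z. Fin (of_nat n * z)) z \<doteq> Fin ((of_nat n - 1) * z) + ln_nat n) \<and>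
     (\<forall>z. vdifferentiable (\<lambda>z. Fin (z ^ n)) z \<and>
        vD (\<lambda>z. Fin (z ^ n)) z \<in>
          clog (of_nat n * z powi (int n - 1) * exp (z ^ n) / exp z) \<and>
        (\<forall>l\<in>clog z. vD (\<lambda>z. Fin (z ^ n)) z \<doteq>
           Fin (z ^ n - z) + cscale (int n - 1) l + ln_nat n)) \<and>
     (\<forall>z. (\<forall>k<n. vdifferentiable ((vD ^^ k) (\<lambda>z. Fin (of_nat n * z))) z) \<and>
        (vD ^^ n) (\<lambda>z. Fin (of_nat n * z)) z \<doteq> Fin (of_real (\<Sum>k=1..n. ln (real k))))"
proof -
  have f: "(f has_field_derivative deriv f z) (at z)" if "z \<in> G" for z
    using that assms(2) analytic_on_imp_differentiable_at DERIV_deriv_iff_field_differentiable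
    by blast
  have g: "(g has_field_derivative deriv g z) (at z)" if "z \<in> G" for z
    using that assms(3) analytic_on_imp_differentiable_at DERIV_deriv_iff_field_differentiable
    by blast
  \<comment> \<open>The rule for the identity is \<open>vD_add_const\<close> with constant 0;
    \<open>mem_vfold_iff\<close> links the two forms of the rule for multiples of
    \<open>z\<close>.\<close>
  show ?thesis
    using vD_const[of "Fin a"] vD_add_const[of 0] vD_add_const[of a] vD_vfold[OF assms(1) _ f]
      vD_vjoin[OF assms(1) _ f g] vD_add[OF f g] vD_mult_nat[of n] vD_power[where n = n]
      vdifferentiable_funpow_mult_nat[of _ n] vD_funpow_mult_nat[of n]
    by (intro conjI allI impI ballI) (simp_all flip: mem_vfold_iff)
qed

end
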